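(* Let $X, Y$ and $Z$ be three finite nonempty sets and let $g\colon X\to Y$ and $f\colon Y\to Z$ be two functions. Then $$\deg(f\circ g)\leq \max_{z\in Z}\{|f^{-1}(z)|\}\,\deg(g).$$
   Context: For a function $h\colon A\to B$ between two finite nonempty sets, the degree of noninvertibility of $h$ is $\deg(h)=\frac{1}{|A|}\sum_{a\in A}|h^{-1}(h(a))|$; equivalently, $\deg(h)=\frac{1}{|A|}\sum_{b\in B}|h^{-1}(b)|^2$. Here $h^{-1}(b)=\{a\in A : h(a)=b\}$. *)

theory Defs
  imports Complex_Main "HOL-Library.FuncSet"
begin

text \<open>
  Functions \<open>h : A \<rightarrow> B\<close> between sets are total HOL functions with \<open>h \<in> A \<rightarrow> B\<close>; the values
  outside \<open>A\<close> are irrelevant, because fibres are taken inside \<open>A\<close>.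
\<close>

definition fiber :: "'a set \<Rightarrow> ('a \<Rightarrow> 'b) \<Rightarrow> 'b \<Rightarrow> 'a set" where
  "fiber A h b = {a \<in> A. h a = b}"

text \<open>
  The degree does not depend on the codomain, which is therefore not an argument; the
  equivalent formula that sums over a codomain is \<open>noninv_degree_eq_sum_squares\<close>.
\<close>

definition noninv_degree :: "'a set \<Rightarrow> ('a \<Rightarrow> 'b) \<Rightarrow> real" where
  "noninv_degree A h = 1 / real (card A) * (\<Sum>a\<in>A. real (card (fiber A h (h a))))"

lemma noninv_degree_eq_sum_squares:
  assumes "finite A" and "finite B" and "h \<in> A \<rightarrow> B"
  shows "noninv_degree A h = 1 / real (card A) * (\<Sum>b\<in>B. (real (card (fiber A h b)))\<^sup>2)"
proof -
  have "(\<Sum>a\<in>A. real (card (fiber A h (h a))))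
      = (\<Sum>b\<in>B. \<Sum>a\<in>{a \<in> A. h a = b}. real (card (fiber A h (h a))))"
    using assms by (intro sum.group [symmetric]) auto
  also have "\<dots> = (\<Sum>b\<in>B. (real (card (fiber A h b)))\<^sup>2)"
    by (intro sum.cong) (auto simp: fiber_def power2_eq_square)
  finally show ?thesis
    by (simp add: noninv_degree_def)
qed

end

theory Submission
  imports Defs "HOL-Analysis.Convex"
begin

text \<open>
  Write \<open>n y\<close> for the size of the fibre of \<open>g\<close> over \<open>y\<close>. The fibre of \<open>f \<circ> g\<close> over \<open>z\<close> is the
  disjoint union of the fibres of \<open>g\<close> over the points \<open>y\<close> of the fibre of \<open>f\<close> over \<open>z\<close>, so its
  size is the sum of these \<open>n y\<close>. By the Cauchy--Schwarz inequality, the square of a sum of \<open>k\<close>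
  numbers is at most \<open>k\<close> times the sum of their squares; here \<open>k\<close> is at most the maximal fibre
  size of \<open>f\<close>. Summing over \<open>z\<close> regroups the squares \<open>(n y)\<^sup>2\<close> into a sum over all of \<open>Y\<close>, and
  the sum-of-squares formula for the degree turns both sides into degrees.
\<close>

lemma card_fiber_comp:
  assumes "finite X" and "finite Y" and "g \<in> X \<rightarrow> Y"
  shows "card (fiber X (f \<circ> g) z) = (\<Sum>y\<in>fiber Y f z. card (fiber X g y))"
proof -
  have "fiber X (f \<circ> g) z = (\<Union>y\<in>fiber Y f z. fiber X g y)"
    using assms by (auto simp: fiber_def)
  then show ?thesis
    using assms by (simp, subst card_UN_disjoint) (auto simp: fiber_def)
qed

theorem theorem2p4:
  fixes X :: "'a set" and Y :: "'b set" and Z :: "'c set"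
    and g :: "'a \<Rightarrow> 'b" and f :: "'b \<Rightarrow> 'c"
  assumes "finite X" and "X \<noteq> {}"
    and "finite Y" and "Y \<noteq> {}"
    and "finite Z" and "Z \<noteq> {}"
    and "g \<in> X \<rightarrow> Y" and "f \<in> Y \<rightarrow> Z"
  shows "noninv_degree X (f \<circ> g) \<le> real (Max ((\<lambda>z. card (fiber Y f z)) ` Z)) * noninv_degree X g"
proof -
  define M where "M = Max ((\<lambda>z. card (fiber Y f z)) ` Z)"
  define n where "n y = real (card (fiber X g y))" for y
  have fiber_bound: "(real (card (fiber X (f \<circ> g) z)))\<^sup>2 \<le> real M * (\<Sum>y\<in>fiber Y f z. (n y)\<^sup>2)"
    if "z \<in> Z" for z
  proof -
    have "(real (card (fiber X (f \<circ> g) z)))\<^sup>2 = (\<Sum>y\<in>fiber Y f z. n y)\<^sup>2"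
      using assms by (simp add: card_fiber_comp n_def)
    also have "\<dots> \<le> real (card (fiber Y f z)) * (\<Sum>y\<in>fiber Y f z. (n y)\<^sup>2)"
      using sum_squared_le_sum_of_squares [of n "fiber Y f z"] by (simp add: mult.commute)
    also have "\<dots> \<le> real M * (\<Sum>y\<in>fiber Y f z. (n y)\<^sup>2)"
      using that assms by (intro mult_right_mono sum_nonneg) (auto simp: M_def)
    finally show ?thesis .
  qed
  have "(\<Sum>z\<in>Z. (real (card (fiber X (f \<circ> g) z)))\<^sup>2)
      \<le> real M * (\<Sum>z\<in>Z. \<Sum>y\<in>fiber Y f z. (n y)\<^sup>2)"
    using fiber_bound by (simp add: sum_distrib_left sum_mono)
  also have "(\<Sum>z\<in>Z. \<Sum>y\<in>fiber Y f z. (n y)\<^sup>2) = (\<Sum>y\<in>Y. (n y)\<^sup>2)"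
    unfolding fiber_def using assms by (intro sum.group) auto
  finally have "1 / real (card X) * (\<Sum>z\<in>Z. (real (card (fiber X (f \<circ> g) z)))\<^sup>2)
      \<le> 1 / real (card X) * (real M * (\<Sum>y\<in>Y. (n y)\<^sup>2))"
    by (rule mult_left_mono) simp
  moreover have "f \<circ> g \<in> X \<rightarrow> Z"
    using assms by auto
  ultimately show ?thesis
    using assms by (simp add: noninv_degree_eq_sum_squares [of X Z] noninv_degree_eq_sum_squares [of X Y]
        M_def n_def)
qed

end
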